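(* For every sequent $\Gamma \Rightarrow \delta$ of first-order arithmetic: if $\mathrm{CHA} \vdash \Gamma \Rightarrow \delta$ then $\mathrm{HA} \vdash \Gamma \Rightarrow \delta$.
   Context: Language: terms are built from variables, $0$, $S$, $+$, $\cdot$; formulas from $s=t$, $\bot$, $\wedge,\vee,\to,\forall,\exists$; $\neg\varphi:=\varphi\to\bot$, $\top:=\bot\to\bot$; $\varphi[t/x]$ is capture-avoiding substitution. A sequent $\Gamma\Rightarrow\delta$ consists of a finite set $\Gamma$ of formulas and a single formula $\delta$. $\mathrm{HA}$ (Heyting arithmetic) is the sequent calculus whose proofs are finite trees built from: the intuitionistic rules Ax ($\Gamma,\delta\Rightarrow\delta$), $\to$L, $\to$R, $\wedge$L, $\wedge$R, $\vee$L, $\vee$R, $\forall$L, $\forall$R and $\exists$L (with the usual eigenvariable conditions), $\exists$R, $\bot$L ($\Gamma,\bot\Rightarrow\delta$), $=$L (from $\Gamma[x/y]\Rightarrow\delta[x/y]$ infer $\Gamma[s/x,t/y], s=t\Rightarrow\delta[s/x,t/y]$, where $x,y\notin \mathrm{FV}(s,t)$), $=$R ($\Gamma\Rightarrow t=t$), weakening (from $\Gamma\Rightarrow\delta$ infer $\Gamma,\Gamma'\Rightarrow\delta$), cut (from $\Gamma\Rightarrow\varphi$ and $\Gamma,\varphi\Rightarrow\delta$ infer $\Gamma\Rightarrow\delta$); the arithmetic axioms $\Rightarrow 0\neq St$, $Ss=St\Rightarrow s=t$, $\Rightarrow s+0=s$, $\Rightarrow s+St=S(s+t)$, $\Rightarrow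 s\cdot 0=0$, $\Rightarrow s\cdot St=(s\cdot t)+s$; and the induction axioms $\varphi(0), \forall x.\,\varphi(x)\to\varphi(Sx)\Rightarrow\varphi(s)$ for every formula $\varphi$ and term $s$. $\mathrm{CHA}$ (cyclic Heyting arithmetic): its rules are those of $\mathrm{HA}$ without the induction axioms, plus the rule $\textsc{Case}_x$: from $\Gamma[0/x]\Rightarrow\delta[0/x]$ and $\Gamma[Sx/x]\Rightarrow\delta[Sx/x]$ infer $\Gamma\Rightarrow\delta$. A cyclic tree is a pair $(T,\beta)$ of a finite tree $T$ and a partial map $\beta$ from leaves of $T$ to inner nodes of $T$; leaves in $\mathrm{dom}(\beta)$ are buds and $\beta(t)$ is the companion of $t$. A pre-proof is a cyclic tree together with an assignment of rule instances to all non-bud nodes such that the children of a node are labelled by the premises of its rule, and each bud is labelled with the same sequent as its companion. An infinite branch is an infinite sequence of nodes starting at the root in which each next node is either a child of the current node or, if the current node is a bud, its companion. A variable $x$ has a trace along an infinite branch if from some point on $x$ is free in every sequent of the branch; the trace is progressing if the branch passes through instances of $\textsc{Case}_x$ infinitely often. A pre-proof is a $\mathrm{CHA}$-proof if along every infinite branch some variable has a progressing trace. $\mathrm{CHA}\vdash\Gamma\Rightarrow\delta$ means there is a $\mathrm{CHA}$-proof whose root is labelled $\Gamma\Rightarrow\delta$. *)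

theory Defs
  imports Main "HOL-Library.FSet"
begin

text \<open>
  Formulas are taken up to renaming of bound variables, which is realised with de Bruijn indices:
  below \<open>d\<close> quantifiers, index \<open>i < d\<close> is bound and index \<open>d + x\<close> denotes the free variable \<open>x\<close>.
  Free variables thus have fixed names (natural numbers), as is needed for traces.
  The quantifiers \<open>\<forall>x. \<phi>\<close> and \<open>\<exists>x. \<phi>\<close> binding a named variable are
  \<open>FORALL x \<phi>\<close> and \<open>EXISTS x \<phi>\<close> below; by \<open>All_named\<close> and \<open>Ex_named\<close>
  every quantified formula is of this form, and \<open>FORALL_rename\<close>, \<open>subst_FORALL\<close> and their
  counterparts for \<open>EXISTS\<close> are the usual laws of renaming and substitution.
\<close>

datatype tm = Var nat | Zero | Succ tm | Plus tm tm | Times tm tm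

datatype fm =
    Eq tm tm
  | Bot
  | And fm fm
  | Or fm fm
  | Imp fm fm
  | All fm
  | Ex fm

abbreviation Neg :: "fm \<Rightarrow> fm" where
  "Neg \<phi> \<equiv> Imp \<phi> Bot"

primrec fv_tm :: "tm \<Rightarrow> nat set" where
  "fv_tm (Var x) = {x}"
| "fv_tm Zero = {}"
| "fv_tm (Succ t) = fv_tm t"
| "fv_tm (Plus s t) = fv_tm s \<union> fv_tm t"
| "fv_tm (Times s t) = fv_tm s \<union> fv_tm t"

primrec fv_fm :: "fm \<Rightarrow> nat set" where
  "fv_fm (Eq s t) = fv_tm s \<union> fv_tm t"
| "fv_fm Bot = {}"
| "fv_fm (And \<phi> \<psi>) = fv_fm \<phi> \<union> fv_fm \<psi>"
| "fv_fm (Or \<phi> \<psi>) = fv_fm \<phi> \<union> fv_fm \<psi>"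
| "fv_fm (Imp \<phi> \<psi>) = fv_fm \<phi> \<union> fv_fm \<psi>"
| "fv_fm (All \<phi>) = {x. Suc x \<in> fv_fm \<phi>}"
| "fv_fm (Ex \<phi>) = {x. Suc x \<in> fv_fm \<phi>}"

primrec subst_tm :: "(nat \<Rightarrow> tm) \<Rightarrow> tm \<Rightarrow> tm" where
  "subst_tm \<sigma> (Var x) = \<sigma> x"
| "subst_tm \<sigma> Zero = Zero"
| "subst_tm \<sigma> (Succ t) = Succ (subst_tm \<sigma> t)"
| "subst_tm \<sigma> (Plus s t) = Plus (subst_tm \<sigma> s) (subst_tm \<sigma> t)"
| "subst_tm \<sigma> (Times s t) = Times (subst_tm \<sigma> s) (subst_tm \<sigma> t)"

definition up :: "(nat \<Rightarrow> tm) \<Rightarrow> nat \<Rightarrow> tm" where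
  "up \<sigma> = case_nat (Var 0) (\<lambda>x. subst_tm (\<lambda>y. Var (Suc y)) (\<sigma> x))"

text \<open>
  Simultaneous capture-avoiding substitution. The substitution \<open>\<phi>[t/x]\<close> is
  \<open>subst_fm (Var(x := t)) \<phi>\<close>, and \<open>\<phi>[s/x, t/y]\<close> is \<open>subst_fm (Var(x := s, y := t)) \<phi>\<close>.
\<close>

primrec subst_fm :: "(nat \<Rightarrow> tm) \<Rightarrow> fm \<Rightarrow> fm" where
  "subst_fm \<sigma> (Eq s t) = Eq (subst_tm \<sigma> s) (subst_tm \<sigma> t)"
| "subst_fm \<sigma> Bot = Bot"
| "subst_fm \<sigma> (And \<phi> \<psi>) = And (subst_fm \<sigma> \<phi>) (subst_fm \<sigma> \<psi>)"
| "subst_fm \<sigma> (Or \<phi> \<psi>) = Or (subst_fm \<sigma> \<phi>) (subst_fm \<sigma> \<psi>)"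
| "subst_fm \<sigma> (Imp \<phi> \<psi>) = Imp (subst_fm \<sigma> \<phi>) (subst_fm \<sigma> \<psi>)"
| "subst_fm \<sigma> (All \<phi>) = All (subst_fm (up \<sigma>) \<phi>)"
| "subst_fm \<sigma> (Ex \<phi>) = Ex (subst_fm (up \<sigma>) \<phi>)"

definition bind_var :: "nat \<Rightarrow> fm \<Rightarrow> fm" where
  "bind_var x = subst_fm (\<lambda>y. if y = x then Var 0 else Var (Suc y))"

definition FORALL :: "nat \<Rightarrow> fm \<Rightarrow> fm" where
  "FORALL x \<phi> = All (bind_var x \<phi>)"

definition EXISTS :: "nat \<Rightarrow> fm \<Rightarrow> fm" where
  "EXISTS x \<phi> = Ex (bind_var x \<phi>)"

lemma fv_subst_tm: "fv_tm (subst_tm \<sigma> t) = (\<Union>x\<in>fv_tm t. fv_tm (\<sigma> x))"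
  by (induction t) auto

lemma fv_up: "Suc z \<in> fv_tm (up \<sigma> x) \<longleftrightarrow> (\<exists>y. x = Suc y \<and> z \<in> fv_tm (\<sigma> y))"
  by (cases x) (auto simp: up_def fv_subst_tm)

lemma fv_subst_fm: "fv_fm (subst_fm \<sigma> \<phi>) = (\<Union>x\<in>fv_fm \<phi>. fv_tm (\<sigma> x))"
proof (induction \<phi> arbitrary: \<sigma>)
  case (All \<phi>)
  show ?case by (simp add: All.IH set_eq_iff fv_up) blast
next
  case (Ex \<phi>)
  show ?case by (simp add: Ex.IH set_eq_iff fv_up) blast
qed (simp_all add: fv_subst_tm)

lemma subst_tm_cong: "(\<And>x. x \<in> fv_tm t \<Longrightarrow> \<sigma> x = \<tau> x) \<Longrightarrow> subst_tm \<sigma> t = subst_tm \<tau> t"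
  by (induction t) auto

lemma up_cong: "(\<And>x. Suc x \<in> A \<Longrightarrow> \<sigma> x = \<tau> x) \<Longrightarrow> y \<in> A \<Longrightarrow> up \<sigma> y = up \<tau> y"
  by (cases y) (auto simp: up_def)

lemma subst_fm_cong: "(\<And>x. x \<in> fv_fm \<phi> \<Longrightarrow> \<sigma> x = \<tau> x) \<Longrightarrow> subst_fm \<sigma> \<phi> = subst_fm \<tau> \<phi>"
proof (induction \<phi> arbitrary: \<sigma> \<tau>)
  case (Eq s t)
  then show ?case by (auto intro: subst_tm_cong)
next
  case (All \<phi>)
  have "subst_fm (up \<sigma>) \<phi> = subst_fm (up \<tau>) \<phi>"
    by (rule All.IH, rule up_cong[of "fv_fm \<phi>"]) (auto intro: All.prems)
  then show ?case by simp
next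
  case (Ex \<phi>)
  have "subst_fm (up \<sigma>) \<phi> = subst_fm (up \<tau>) \<phi>"
    by (rule Ex.IH, rule up_cong[of "fv_fm \<phi>"]) (auto intro: Ex.prems)
  then show ?case by simp
next
  case (And \<phi> \<psi>)
  then have "subst_fm \<sigma> \<phi> = subst_fm \<tau> \<phi>" "subst_fm \<sigma> \<psi> = subst_fm \<tau> \<psi>"
    by (metis UnI1 UnI2 fv_fm.simps(3))+
  then show ?case by simp
next
  case (Or \<phi> \<psi>)
  then have "subst_fm \<sigma> \<phi> = subst_fm \<tau> \<phi>" "subst_fm \<sigma> \<psi> = subst_fm \<tau> \<psi>"
    by (metis UnI1 UnI2 fv_fm.simps(4))+
  then show ?case by simp
next
  case (Imp \<phi> \<psi>)
  then have "subst_fm \<sigma> \<phi> = subst_fm \<tau> \<phi>" "subst_fm \<sigma> \<psi> = subst_fm \<tau> \<psi>"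
    by (metis UnI1 UnI2 fv_fm.simps(5))+
  then show ?case by simp
qed simp

lemma subst_tm_comp: "subst_tm \<sigma> (subst_tm \<tau> t) = subst_tm (\<lambda>x. subst_tm \<sigma> (\<tau> x)) t"
  by (induction t) auto

lemma up_comp: "subst_tm (up \<sigma>) (up \<tau> x) = up (\<lambda>x. subst_tm \<sigma> (\<tau> x)) x"
  by (cases x) (auto simp: up_def subst_tm_comp)

lemma subst_fm_comp: "subst_fm \<sigma> (subst_fm \<tau> \<phi>) = subst_fm (\<lambda>x. subst_tm \<sigma> (\<tau> x)) \<phi>"
  by (induction \<phi> arbitrary: \<sigma> \<tau>) (auto simp: subst_tm_comp up_comp)

lemma up_Var: "up Var = Var"
  by (auto simp: up_def split: nat.splits)

lemma subst_tm_Var: "subst_tm Var t = t"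
  by (induction t) auto

lemma subst_fm_Var: "subst_fm Var \<phi> = \<phi>"
  by (induction \<phi>) (auto simp: subst_tm_Var up_Var)

lemma fv_FORALL: "fv_fm (FORALL x \<phi>) = fv_fm \<phi> - {x}"
  by (auto simp: FORALL_def bind_var_def fv_subst_fm split: if_splits)

lemma fv_EXISTS: "fv_fm (EXISTS x \<phi>) = fv_fm \<phi> - {x}"
  by (auto simp: EXISTS_def bind_var_def fv_subst_fm split: if_splits)

lemma bind_rename:
  assumes "y \<notin> fv_fm \<phi> - {x}"
  shows "bind_var y (subst_fm (Var(x := Var y)) \<phi>) = bind_var x \<phi>"
  unfolding bind_var_def subst_fm_comp by (rule subst_fm_cong) (use assms in auto)

lemma FORALL_rename:
  "y \<notin> fv_fm \<phi> - {x} \<Longrightarrow> FORALL y (subst_fm (Var(x := Var y)) \<phi>) = FORALL x \<phi>"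
  by (simp add: FORALL_def bind_rename)

lemma EXISTS_rename:
  "y \<notin> fv_fm \<phi> - {x} \<Longrightarrow> EXISTS y (subst_fm (Var(x := Var y)) \<phi>) = EXISTS x \<phi>"
  by (simp add: EXISTS_def bind_rename)

lemma up_bind:
  assumes "\<And>y. y \<in> fv_fm \<phi> - {x} \<Longrightarrow> x \<notin> fv_tm (\<sigma> y)"
  shows "subst_fm (up \<sigma>) (bind_var x \<phi>) = bind_var x (subst_fm (\<sigma>(x := Var x)) \<phi>)"
  unfolding bind_var_def subst_fm_comp
proof (rule subst_fm_cong)
  fix y assume y: "y \<in> fv_fm \<phi>"
  let ?\<rho> = "\<lambda>z. if z = x then Var 0 else Var (Suc z)"
  show "subst_tm (up \<sigma>) (?\<rho> y) = subst_tm ?\<rho> ((\<sigma>(x := Var x)) y)"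
  proof (cases "y = x")
    case False
    with y assms[of y] have "x \<notin> fv_tm (\<sigma> y)" by simp
    then have "subst_tm (\<lambda>z. Var (Suc z)) (\<sigma> y) = subst_tm ?\<rho> (\<sigma> y)"
      by (intro subst_tm_cong) auto
    with False show ?thesis by (simp add: up_def)
  qed (simp add: up_def)
qed

lemma subst_FORALL:
  "(\<And>y. y \<in> fv_fm \<phi> - {x} \<Longrightarrow> x \<notin> fv_tm (\<sigma> y)) \<Longrightarrow>
   subst_fm \<sigma> (FORALL x \<phi>) = FORALL x (subst_fm (\<sigma>(x := Var x)) \<phi>)"
  unfolding FORALL_def subst_fm.simps fm.inject by (rule up_bind)

lemma subst_EXISTS:
  "(\<And>y. y \<in> fv_fm \<phi> - {x} \<Longrightarrow> x \<notin> fv_tm (\<sigma> y)) \<Longrightarrow>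
   subst_fm \<sigma> (EXISTS x \<phi>) = EXISTS x (subst_fm (\<sigma>(x := Var x)) \<phi>)"
  unfolding EXISTS_def subst_fm.simps fm.inject by (rule up_bind)

lemma bind_surj:
  assumes "x \<notin> fv_fm (All \<phi>)"
  shows "bind_var x (subst_fm (case_nat (Var x) Var) \<phi>) = \<phi>"
proof -
  have "bind_var x (subst_fm (case_nat (Var x) Var) \<phi>) = subst_fm Var \<phi>"
    unfolding bind_var_def subst_fm_comp
    by (rule subst_fm_cong) (use assms in \<open>auto split: nat.splits\<close>)
  then show ?thesis by (simp add: subst_fm_Var)
qed

lemma All_named: "x \<notin> fv_fm (All \<phi>) \<Longrightarrow> FORALL x (subst_fm (case_nat (Var x) Var) \<phi>) = All \<phi>"
  by (simp add: FORALL_def bind_surj)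

lemma Ex_named: "x \<notin> fv_fm (Ex \<phi>) \<Longrightarrow> EXISTS x (subst_fm (case_nat (Var x) Var) \<phi>) = Ex \<phi>"
  by (simp add: EXISTS_def bind_surj)


datatype sequent = Sequent "fm fset" fm  (infix "\<rhd>" 55)

definition fv_ctx :: "fm fset \<Rightarrow> nat set" where
  "fv_ctx \<Gamma> = (\<Union>\<phi>\<in>fset \<Gamma>. fv_fm \<phi>)"

primrec fv_seq :: "sequent \<Rightarrow> nat set" where
  "fv_seq (\<Gamma> \<rhd> \<delta>) = fv_ctx \<Gamma> \<union> fv_fm \<delta>"

primrec subst_seq :: "(nat \<Rightarrow> tm) \<Rightarrow> sequent \<Rightarrow> sequent" where
  "subst_seq \<sigma> (\<Gamma> \<rhd> \<delta>) = (subst_fm \<sigma> |`| \<Gamma>) \<rhd> subst_fm \<sigma> \<delta>"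

text \<open>
  \<open>base_rule Ps S\<close>: the list \<open>Ps\<close> of premises and the conclusion \<open>S\<close> form an instance of one of the
  rules shared by HA and CHA. A context \<open>finsert \<phi> \<Gamma>\<close> may have \<open>\<phi> |\<in>| \<Gamma>\<close>, so contraction is
  built in. Since formulas are taken up to renaming of bound variables, \<open>AllR\<close> and \<open>ExL\<close> may
  use the bound variable itself as eigenvariable. In \<open>EqL\<close>, the condition \<open>x \<noteq> y\<close> makes the
  substitution \<open>[s/x, t/y]\<close> unambiguous.
\<close>

inductive base_rule :: "sequent list \<Rightarrow> sequent \<Rightarrow> bool" where
  Ax: "base_rule [] (finsert \<delta> \<Gamma> \<rhd> \<delta>)"
| ImpL: "base_rule [\<Gamma> \<rhd> \<phi>, finsert \<psi> \<Gamma> \<rhd> \<delta>] (finsert (Imp \<phi> \<psi>) \<Gamma> \<rhd> \<delta>)"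
| ImpR: "base_rule [finsert \<phi> \<Gamma> \<rhd> \<psi>] (\<Gamma> \<rhd> Imp \<phi> \<psi>)"
| AndL: "base_rule [finsert \<phi> (finsert \<psi> \<Gamma>) \<rhd> \<delta>] (finsert (And \<phi> \<psi>) \<Gamma> \<rhd> \<delta>)"
| AndR: "base_rule [\<Gamma> \<rhd> \<phi>, \<Gamma> \<rhd> \<psi>] (\<Gamma> \<rhd> And \<phi> \<psi>)"
| OrL: "base_rule [finsert \<phi> \<Gamma> \<rhd> \<delta>, finsert \<psi> \<Gamma> \<rhd> \<delta>] (finsert (Or \<phi> \<psi>) \<Gamma> \<rhd> \<delta>)"
| OrR1: "base_rule [\<Gamma> \<rhd> \<phi>] (\<Gamma> \<rhd> Or \<phi> \<psi>)"
| OrR2: "base_rule [\<Gamma> \<rhd> \<psi>] (\<Gamma> \<rhd> Or \<phi> \<psi>)"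
| AllL: "base_rule [finsert (subst_fm (Var(x := t)) \<phi>) \<Gamma> \<rhd> \<delta>] (finsert (FORALL x \<phi>) \<Gamma> \<rhd> \<delta>)"
| AllR: "x \<notin> fv_ctx \<Gamma> \<Longrightarrow> base_rule [\<Gamma> \<rhd> \<phi>] (\<Gamma> \<rhd> FORALL x \<phi>)"
| ExL: "x \<notin> fv_ctx \<Gamma> \<union> fv_fm \<delta> \<Longrightarrow> base_rule [finsert \<phi> \<Gamma> \<rhd> \<delta>] (finsert (EXISTS x \<phi>) \<Gamma> \<rhd> \<delta>)"
| ExR: "base_rule [\<Gamma> \<rhd> subst_fm (Var(x := t)) \<phi>] (\<Gamma> \<rhd> EXISTS x \<phi>)"
| BotL: "base_rule [] (finsert Bot \<Gamma> \<rhd> \<delta>)"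
| EqL: "x \<noteq> y \<Longrightarrow> x \<notin> fv_tm s \<union> fv_tm t \<Longrightarrow> y \<notin> fv_tm s \<union> fv_tm t \<Longrightarrow>
    base_rule [subst_seq (Var(y := Var x)) (\<Gamma> \<rhd> \<delta>)]
      (finsert (Eq s t) (subst_fm (Var(x := s, y := t)) |`| \<Gamma>) \<rhd> subst_fm (Var(x := s, y := t)) \<delta>)"
| EqR: "base_rule [] (\<Gamma> \<rhd> Eq t t)"
| Weak: "base_rule [\<Gamma> \<rhd> \<delta>] (\<Gamma> |\<union>| \<Gamma>' \<rhd> \<delta>)"
| Cut: "base_rule [\<Gamma> \<rhd> \<phi>, finsert \<phi> \<Gamma> \<rhd> \<delta>] (\<Gamma> \<rhd> \<delta>)"
| Zero_neq_Succ: "base_rule [] ({||} \<rhd> Neg (Eq Zero (Succ t)))"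
| Succ_inj: "base_rule [] ({|Eq (Succ s) (Succ t)|} \<rhd> Eq s t)"
| Plus_Zero: "base_rule [] ({||} \<rhd> Eq (Plus s Zero) s)"
| Plus_Succ: "base_rule [] ({||} \<rhd> Eq (Plus s (Succ t)) (Succ (Plus s t)))"
| Times_Zero: "base_rule [] ({||} \<rhd> Eq (Times s Zero) Zero)"
| Times_Succ: "base_rule [] ({||} \<rhd> Eq (Times s (Succ t)) (Plus (Times s t) s))"

inductive HA :: "sequent \<Rightarrow> bool" where
  Rule: "base_rule Ps S \<Longrightarrow> (\<forall>P\<in>set Ps. HA P) \<Longrightarrow> HA S"
| Induction: "HA ({|subst_fm (Var(x := Zero)) \<phi>,
      FORALL x (Imp \<phi> (subst_fm (Var(x := Succ (Var x))) \<phi>))|} \<rhd> subst_fm (Var(x := s)) \<phi>)"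

text \<open>
  A rule instance of CHA consists of its premises, its conclusion and a tag. Traces only depend
  on whether the rule is \<open>Case\<^sub>x\<close>, so the rules shared with HA have a common tag.
\<close>

datatype tag = Basic | Case nat

fun cha_rule :: "tag \<Rightarrow> sequent list \<Rightarrow> sequent \<Rightarrow> bool" where
  "cha_rule Basic Ps S \<longleftrightarrow> base_rule Ps S"
| "cha_rule (Case x) Ps S \<longleftrightarrow>
     Ps = [subst_seq (Var(x := Zero)) S, subst_seq (Var(x := Succ (Var x))) S]"

text \<open>A node is given by its position; the children of \<open>p\<close> are the nodes \<open>p @ [i]\<close>.\<close>

type_synonym node = "nat list"

definition finite_tree :: "node set \<Rightarrow> bool" where
  "finite_tree T \<longleftrightarrow> finite T \<and> [] \<in> T \<and>
     (\<forall>p i. p @ [i] \<in> T \<longrightarrow> p \<in> T \<and> (\<forall>j<i. p @ [j] \<in> T))"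

definition leaves :: "node set \<Rightarrow> node set" where
  "leaves T = {p \<in> T. \<forall>i. p @ [i] \<notin> T}"

definition inner_nodes :: "node set \<Rightarrow> node set" where
  "inner_nodes T = T - leaves T"

definition cyclic_tree :: "node set \<Rightarrow> (node \<rightharpoonup> node) \<Rightarrow> bool" where
  "cyclic_tree T \<beta> \<longleftrightarrow> finite_tree T \<and> dom \<beta> \<subseteq> leaves T \<and> ran \<beta> \<subseteq> inner_nodes T"

definition pre_proof ::
  "node set \<Rightarrow> (node \<rightharpoonup> node) \<Rightarrow> (node \<Rightarrow> sequent) \<Rightarrow> (node \<rightharpoonup> tag) \<Rightarrow> bool" where
  "pre_proof T \<beta> lab r \<longleftrightarrow>
     cyclic_tree T \<beta> \<and>
     dom r = T - dom \<beta> \<and>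
     (\<forall>p k. r p = Some k \<longrightarrow>
        (\<exists>Ps. cha_rule k Ps (lab p) \<and> (\<forall>i. p @ [i] \<in> T \<longleftrightarrow> i < length Ps) \<and>
              (\<forall>i<length Ps. lab (p @ [i]) = Ps ! i))) \<and>
     (\<forall>p c. \<beta> p = Some c \<longrightarrow> lab p = lab c)"

definition infinite_branch :: "node set \<Rightarrow> (node \<rightharpoonup> node) \<Rightarrow> (nat \<Rightarrow> node) \<Rightarrow> bool" where
  "infinite_branch T \<beta> b \<longleftrightarrow>
     b 0 = [] \<and> (\<forall>n. b n \<in> T) \<and>
     (\<forall>n. (\<exists>i. b (Suc n) = b n @ [i]) \<or> \<beta> (b n) = Some (b (Suc n)))"

definition has_trace :: "(node \<Rightarrow> sequent) \<Rightarrow> (nat \<Rightarrow> node) \<Rightarrow> nat \<Rightarrow> bool" where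
  "has_trace lab b x \<longleftrightarrow> (\<exists>N. \<forall>n\<ge>N. x \<in> fv_seq (lab (b n)))"

definition has_progressing_trace ::
  "(node \<Rightarrow> sequent) \<Rightarrow> (node \<rightharpoonup> tag) \<Rightarrow> (nat \<Rightarrow> node) \<Rightarrow> nat \<Rightarrow> bool" where
  "has_progressing_trace lab r b x \<longleftrightarrow>
     has_trace lab b x \<and> (\<exists>\<^sub>\<infinity>n. r (b n) = Some (Case x))"

definition CHA_proof ::
  "node set \<Rightarrow> (node \<rightharpoonup> node) \<Rightarrow> (node \<Rightarrow> sequent) \<Rightarrow> (node \<rightharpoonup> tag) \<Rightarrow> bool" where
  "CHA_proof T \<beta> lab r \<longleftrightarrow>
     pre_proof T \<beta> lab r \<and>
     (\<forall>b. infinite_branch T \<beta> b \<longrightarrow> (\<exists>x. has_progressing_trace lab r b x))"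

definition CHA :: "sequent \<Rightarrow> bool" where
  "CHA S \<longleftrightarrow> (\<exists>T \<beta> lab r. CHA_proof T \<beta> lab r \<and> lab [] = S)"

end

theory Submission
  imports Defs "HOL-Library.Infinite_Set"
begin

text \<open>
  Traces never change their variable, so the global condition says: every strongly connected set
  of nodes containing an edge has a variable \<open>z\<close> that is free in all its sequents and some
  \<open>Case\<^sub>z\<close> node. Deleting the \<open>Case\<^sub>z\<close> nodes and decomposing the rest again yields nested
  inductions. For one such set \<open>C\<close>, let \<open>\<kappa>(z)\<close> be the conjunction of the universal closures,
  except for \<open>z\<close> and the outer induction variables, of the sequents at its \<open>Case\<^sub>z\<close> nodes.
  Recursively, all sequents in \<open>C\<close> follow from \<open>\<kappa>(z)\<close>. In particular so do the right premises
  of the \<open>Case\<^sub>z\<close> nodes, which together amount to \<open>\<kappa>(Sz)\<close>. The left premises amount to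
  \<open>\<kappa>(0)\<close>; they do not contain \<open>z\<close>, hence lie outside \<open>C\<close> and are already proved.
  So HA proves \<open>\<kappa>(z)\<close> by induction, and with it every sequent in \<open>C\<close>.
\<close>

section \<open>Derived rules of HA\<close>

lemma HA_ax: "\<delta> |\<in>| \<Gamma> \<Longrightarrow> HA (\<Gamma> \<rhd> \<delta>)"
  using HA.Rule[OF base_rule.Ax[of \<delta> \<Gamma>]] by (simp add: finsert_absorb)

lemma HA_weak:
  assumes "HA (\<Gamma> \<rhd> \<delta>)" "\<Gamma> |\<subseteq>| \<Gamma>'"
  shows "HA (\<Gamma>' \<rhd> \<delta>)"
  using HA.Rule[OF base_rule.Weak[of \<Gamma> \<delta> \<Gamma>']] assms by (simp add: sup.absorb2)

lemma HA_cut: "HA (\<Gamma> \<rhd> \<phi>) \<Longrightarrow> HA (finsert \<phi> \<Gamma> \<rhd> \<delta>) \<Longrightarrow> HA (\<Gamma> \<rhd> \<delta>)"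
  using HA.Rule[OF base_rule.Cut[of \<Gamma> \<phi> \<delta>]] by simp

text \<open>A cut against the left rule inverts the right rule; the same works for conjunction and
  the universal quantifier below. As equivalences, these facts let the simplifier turn a formula
  that encodes sequents back into the sequents.\<close>

lemma HA_Imp_iff: "HA (\<Gamma> \<rhd> Imp \<phi> \<psi>) \<longleftrightarrow> HA (finsert \<phi> \<Gamma> \<rhd> \<psi>)"
proof
  assume "HA (\<Gamma> \<rhd> Imp \<phi> \<psi>)"
  then have *: "HA (finsert \<phi> \<Gamma> \<rhd> Imp \<phi> \<psi>)"
    by (rule HA_weak) auto
  have "HA (finsert (Imp \<phi> \<psi>) (finsert \<phi> \<Gamma>) \<rhd> \<psi>)"
    by (rule HA.Rule[OF base_rule.ImpL]) (auto intro: HA_ax)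
  with * show "HA (finsert \<phi> \<Gamma> \<rhd> \<psi>)" by (rule HA_cut)
next
  assume "HA (finsert \<phi> \<Gamma> \<rhd> \<psi>)"
  then show "HA (\<Gamma> \<rhd> Imp \<phi> \<psi>)"
    by (intro HA.Rule[OF base_rule.ImpR]) auto
qed

lemma HA_And_iff: "HA (\<Gamma> \<rhd> And \<phi> \<psi>) \<longleftrightarrow> HA (\<Gamma> \<rhd> \<phi>) \<and> HA (\<Gamma> \<rhd> \<psi>)"
proof
  assume *: "HA (\<Gamma> \<rhd> And \<phi> \<psi>)"
  have "HA (finsert (And \<phi> \<psi>) \<Gamma> \<rhd> \<phi>)" "HA (finsert (And \<phi> \<psi>) \<Gamma> \<rhd> \<psi>)"
    by (rule HA.Rule[OF base_rule.AndL], auto intro: HA_ax)+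
  then show "HA (\<Gamma> \<rhd> \<phi>) \<and> HA (\<Gamma> \<rhd> \<psi>)"
    using HA_cut[OF *] by blast
next
  assume "HA (\<Gamma> \<rhd> \<phi>) \<and> HA (\<Gamma> \<rhd> \<psi>)"
  then show "HA (\<Gamma> \<rhd> And \<phi> \<psi>)"
    by (intro HA.Rule[OF base_rule.AndR]) auto
qed

lemma HA_FORALL_iff:
  assumes "x \<notin> fv_ctx \<Gamma>"
  shows "HA (\<Gamma> \<rhd> FORALL x \<phi>) \<longleftrightarrow> HA (\<Gamma> \<rhd> \<phi>)"
proof
  assume *: "HA (\<Gamma> \<rhd> FORALL x \<phi>)"
  have "HA (finsert (FORALL x \<phi>) \<Gamma> \<rhd> \<phi>)"
    by (rule HA.Rule[OF base_rule.AllL[of x "Var x"]]) (auto simp: subst_fm_Var intro: HA_ax)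
  with * show "HA (\<Gamma> \<rhd> \<phi>)" by (rule HA_cut)
next
  assume "HA (\<Gamma> \<rhd> \<phi>)"
  with assms show "HA (\<Gamma> \<rhd> FORALL x \<phi>)"
    by (intro HA.Rule[OF base_rule.AllR]) auto
qed

text \<open>The induction axiom has no side formulas. Its quantified step is provable from
  \<open>\<Gamma>\<close> because the eigenvariable \<open>x\<close> is not free there; two cuts
  then remove both hypotheses of the axiom.\<close>

lemma HA_induct:
  assumes "x \<notin> fv_ctx \<Gamma>"
    and zero: "HA (\<Gamma> \<rhd> subst_fm (Var(x := Zero)) \<phi>)"
    and succ: "HA (finsert \<phi> \<Gamma> \<rhd> subst_fm (Var(x := Succ (Var x))) \<phi>)"
  shows "HA (\<Gamma> \<rhd> \<phi>)"
proof -
  let ?z = "subst_fm (Var(x := Zero)) \<phi>"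
  let ?s = "FORALL x (Imp \<phi> (subst_fm (Var(x := Succ (Var x))) \<phi>))"
  \<comment> \<open>With \<open>Var x\<close> as the term, the substitution is the identity, so the
    axiom concludes \<open>\<phi>\<close> itself.\<close>
  have "HA ({|?z, ?s|} \<rhd> subst_fm (Var(x := Var x)) \<phi>)" by (rule HA.Induction)
  then have "HA (finsert ?z (finsert ?s \<Gamma>) \<rhd> \<phi>)"
    unfolding fun_upd_triv subst_fm_Var by (rule HA_weak) auto
  moreover have s: "HA (\<Gamma> \<rhd> ?s)"
    using succ assms(1) by (simp add: HA_FORALL_iff HA_Imp_iff)
  moreover have "HA (finsert ?s \<Gamma> \<rhd> ?z)"
    using zero by (rule HA_weak) auto
  ultimately show ?thesis by (blast intro: HA_cut)
qed

section \<open>Effect of substitutions on contexts and sequents\<close>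

lemma subst_fm_id: "(\<And>x. x \<in> fv_fm \<phi> \<Longrightarrow> \<sigma> x = Var x) \<Longrightarrow> subst_fm \<sigma> \<phi> = \<phi>"
  by (metis subst_fm_cong subst_fm_Var)

lemma fimage_subst_fm_id:
  assumes "\<And>x. x \<in> fv_ctx \<Theta> \<Longrightarrow> \<sigma> x = Var x"
  shows "subst_fm \<sigma> |`| \<Theta> = \<Theta>"
proof -
  have "subst_fm \<sigma> \<phi> = \<phi>" if "\<phi> |\<in>| \<Theta>" for \<phi>
    using that assms by (intro subst_fm_id) (auto simp: fv_ctx_def)
  then show ?thesis by force
qed

lemma fv_ctx_simps [simp]:
  "fv_ctx {||} = {}"
  "fv_ctx (finsert \<phi> \<Gamma>) = fv_fm \<phi> \<union> fv_ctx \<Gamma>"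
  "fv_ctx (\<Gamma> |\<union>| \<Gamma>') = fv_ctx \<Gamma> \<union> fv_ctx \<Gamma>'"
  by (auto simp: fv_ctx_def)

lemma fv_ctx_subst: "fv_ctx (subst_fm \<sigma> |`| \<Gamma>) = (\<Union>x\<in>fv_ctx \<Gamma>. fv_tm (\<sigma> x))"
  by (auto simp: fv_ctx_def fv_subst_fm)

lemma fv_subst_seq: "fv_seq (subst_seq \<sigma> S) = (\<Union>x\<in>fv_seq S. fv_tm (\<sigma> x))"
  by (cases S) (simp add: fv_ctx_subst fv_subst_fm)

section \<open>Sequents with additional hypotheses\<close>

primrec with_hyps :: "fm fset \<Rightarrow> sequent \<Rightarrow> sequent" where
  "with_hyps \<Theta> (\<Gamma> \<rhd> \<delta>) = (\<Theta> |\<union>| \<Gamma> \<rhd> \<delta>)"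

lemma with_hyps_mono:
  assumes "HA (with_hyps \<Theta> S)" "\<Theta> |\<subseteq>| \<Theta>'"
  shows "HA (with_hyps \<Theta>' S)"
  using assms by (cases S) (auto elim!: HA_weak)

lemma subst_with_hyps:
  assumes "\<And>x. x \<in> fv_ctx \<Theta> \<Longrightarrow> \<sigma> x = Var x"
  shows "subst_seq \<sigma> (with_hyps \<Theta> S) = with_hyps \<Theta> (subst_seq \<sigma> S)"
  using assms by (cases S) (simp add: fimage_funion fimage_subst_fm_id)

text \<open>
  Eigenvariables, and likewise the two variables substituted in \<open>EqL\<close>, are not free in the
  conclusion; hypotheses whose variables are free there hence violate no side condition.
\<close>

lemma base_rule_with_hyps:
  assumes "base_rule Ps S" "fv_ctx \<Theta> \<subseteq> fv_seq S" "\<forall>P\<in>set Ps. HA (with_hyps \<Theta> P)"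
  shows "HA (with_hyps \<Theta> S)"
  using assms
proof (induction rule: base_rule.induct)
  case (AllR x \<Gamma> \<phi>)
  then have "x \<notin> fv_ctx (\<Theta> |\<union>| \<Gamma>)" by (auto simp: fv_FORALL)
  with AllR show ?case by (simp add: HA_FORALL_iff)
next
  case (ExL x \<Gamma> \<delta> \<phi>)
  then have "x \<notin> fv_ctx (\<Theta> |\<union>| \<Gamma>) \<union> fv_fm \<delta>" by (auto simp: fv_EXISTS)
  from HA.Rule[OF base_rule.ExL[OF this, of \<phi>]] ExL show ?case by simp
next
  case (EqL x y s t \<Gamma> \<delta>)
  let ?\<sigma> = "Var(x := s, y := t)"
  have nfv: "x \<notin> fv_ctx \<Theta>" "y \<notin> fv_ctx \<Theta>"
    using EqL by (auto simp: fv_ctx_subst fv_subst_fm split: if_splits)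
  have 1: "subst_fm (Var(y := Var x)) |`| \<Theta> = \<Theta>" "subst_fm ?\<sigma> |`| \<Theta> = \<Theta>"
    using nfv by (auto intro!: fimage_subst_fm_id)
  from HA.Rule[OF base_rule.EqL[OF EqL(1-3), of "\<Theta> |\<union>| \<Gamma>" \<delta>]] EqL show ?case
    by (simp add: 1 fimage_funion)
next
  case (Weak \<Gamma> \<delta> \<Gamma>')
  then show ?case by (auto elim!: HA_weak)
next
  case (AllL x t \<phi> \<Gamma> \<delta>)
  then show ?case using HA.Rule[OF base_rule.AllL[of x t \<phi> "\<Theta> |\<union>| \<Gamma>" \<delta>]] by simp
next
  case (ExR \<Gamma> x t \<phi>)
  then show ?case using HA.Rule[OF base_rule.ExR[of "\<Theta> |\<union>| \<Gamma>" x t \<phi>]] by simp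
next
  case (Succ_inj s t)
  show ?case using HA.Rule[OF base_rule.Succ_inj[of s t]] by (auto elim!: HA_weak)
next
  case (Zero_neq_Succ t)
  show ?case using HA.Rule[OF base_rule.Zero_neq_Succ[of t]] by (auto elim!: HA_weak)
next
  case (Plus_Zero s)
  show ?case using HA.Rule[OF base_rule.Plus_Zero[of s]] by (auto elim!: HA_weak)
next
  case (Plus_Succ s t)
  show ?case using HA.Rule[OF base_rule.Plus_Succ[of s t]] by (auto elim!: HA_weak)
next
  case (Times_Zero s)
  show ?case using HA.Rule[OF base_rule.Times_Zero[of s]] by (auto elim!: HA_weak)
next
  case (Times_Succ s t)
  show ?case using HA.Rule[OF base_rule.Times_Succ[of s t]] by (auto elim!: HA_weak)
next
  case (ImpL \<Gamma> \<phi> \<psi> \<delta>)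
  then show ?case using HA.Rule[OF base_rule.ImpL[of "\<Theta> |\<union>| \<Gamma>" \<phi> \<psi> \<delta>]] by simp
next
  case (AndL \<phi> \<psi> \<Gamma> \<delta>)
  then show ?case using HA.Rule[OF base_rule.AndL[of \<phi> \<psi> "\<Theta> |\<union>| \<Gamma>" \<delta>]] by simp
next
  case (OrL \<phi> \<Gamma> \<delta> \<psi>)
  then show ?case using HA.Rule[OF base_rule.OrL[of \<phi> "\<Theta> |\<union>| \<Gamma>" \<delta> \<psi>]] by simp
next
  case (OrR1 \<Gamma> \<phi> \<psi>)
  then show ?case using HA.Rule[OF base_rule.OrR1[of "\<Theta> |\<union>| \<Gamma>" \<phi> \<psi>]] by simp
next
  case (OrR2 \<Gamma> \<psi> \<phi>)
  then show ?case using HA.Rule[OF base_rule.OrR2[of "\<Theta> |\<union>| \<Gamma>" \<psi> \<phi>]] by simp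
next
  case (BotL \<Gamma> \<delta>)
  show ?case using HA.Rule[OF base_rule.BotL[of "\<Theta> |\<union>| \<Gamma>" \<delta>]] by simp
next
  case (EqR \<Gamma> t)
  show ?case using HA.Rule[OF base_rule.EqR[of "\<Theta> |\<union>| \<Gamma>" t]] by simp
next
  case (Cut \<Gamma> \<phi> \<delta>)
  then show ?case by (auto intro: HA_cut)
qed (simp_all add: HA_Imp_iff HA_And_iff HA_ax)

section \<open>Internalising finite sets of sequents\<close>

lemma finite_fv_tm [simp]: "finite (fv_tm t)"
  by (induction t) auto

lemma finite_fv_fm [simp]: "finite (fv_fm \<phi>)"
proof (induction \<phi>)
  case (All \<phi>)
  have "{x. Suc x \<in> fv_fm \<phi>} = Suc -` fv_fm \<phi>" by auto
  with All show ?case by (simp add: finite_vimageI)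
next
  case (Ex \<phi>)
  have "{x. Suc x \<in> fv_fm \<phi>} = Suc -` fv_fm \<phi>" by auto
  with Ex show ?case by (simp add: finite_vimageI)
qed auto

text \<open>The context is turned into iterated implications one formula at a time, hence the
  arbitrary \<open>\<delta>\<close> in the induction. One formula serves all \<open>\<Theta>\<close>
  and \<open>\<sigma>\<close> since substitution commutes with implication.\<close>

lemma ex_implication:
  "\<exists>\<phi>. \<forall>\<Theta> \<sigma>. HA (\<Theta> \<rhd> subst_fm \<sigma> \<phi>) \<longleftrightarrow> HA (with_hyps \<Theta> (subst_seq \<sigma> (\<Gamma> \<rhd> \<delta>)))"
proof (induction \<Gamma> arbitrary: \<delta>)
  case empty
  show ?case by (rule exI[of _ \<delta>]) simp
next
  case (insert \<psi> \<Gamma>)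
  obtain \<phi> where \<phi>: "\<And>\<Theta> \<sigma>. HA (\<Theta> \<rhd> subst_fm \<sigma> \<phi>) \<longleftrightarrow> HA (with_hyps \<Theta> (subst_seq \<sigma> (\<Gamma> \<rhd> Imp \<psi> \<delta>)))"
    using insert.IH by blast
  show ?case by (rule exI[of _ \<phi>]) (simp add: \<phi> HA_Imp_iff)
qed

text \<open>The witness is the universal closure over \<open>B\<close>, while the variables in
  \<open>W\<close> stay open. Hypotheses and substitutions confined to \<open>W\<close> neither
  violate the eigenvariable condition nor cause capture at the new quantifiers.\<close>

lemma ex_closure:
  assumes "finite B" "B \<inter> W = {}"
  shows "\<exists>\<psi>. fv_fm \<psi> = fv_fm \<phi> - B \<and>
    (\<forall>\<Theta> \<sigma>. fv_ctx \<Theta> \<subseteq> W \<longrightarrow> (\<forall>x. x \<notin> W \<longrightarrow> \<sigma> x = Var x) \<longrightarrow> (\<forall>x\<in>W. fv_tm (\<sigma> x) \<subseteq> W) \<longrightarrow>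
      (HA (\<Theta> \<rhd> subst_fm \<sigma> \<psi>) \<longleftrightarrow> HA (\<Theta> \<rhd> subst_fm \<sigma> \<phi>)))"
  using assms
proof (induction B)
  case empty
  show ?case by (rule exI[of _ \<phi>]) simp
next
  case (insert x B)
  then obtain \<psi> where fv: "fv_fm \<psi> = fv_fm \<phi> - B"
    and \<psi>: "\<And>\<Theta> \<sigma>. fv_ctx \<Theta> \<subseteq> W \<Longrightarrow> (\<forall>x. x \<notin> W \<longrightarrow> \<sigma> x = Var x) \<Longrightarrow>
      (\<forall>x\<in>W. fv_tm (\<sigma> x) \<subseteq> W) \<Longrightarrow> HA (\<Theta> \<rhd> subst_fm \<sigma> \<psi>) \<longleftrightarrow> HA (\<Theta> \<rhd> subst_fm \<sigma> \<phi>)"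
    by (metis Int_insert_left insert_not_empty)
  have x: "x \<notin> W" using insert.prems by auto
  show ?case
  proof (intro exI[of _ "FORALL x \<psi>"] conjI allI impI)
    show "fv_fm (FORALL x \<psi>) = fv_fm \<phi> - insert x B"
      by (auto simp: fv_FORALL fv)
    fix \<Theta> \<sigma>
    assume \<Theta>: "fv_ctx \<Theta> \<subseteq> W" and \<sigma>: "\<forall>x. x \<notin> W \<longrightarrow> \<sigma> x = Var x" "\<forall>x\<in>W. fv_tm (\<sigma> x) \<subseteq> W"
    have "x \<notin> fv_tm (\<sigma> y)" if "y \<noteq> x" for y
      using \<sigma> x that by (cases "y \<in> W") auto
    moreover have "\<sigma>(x := Var x) = \<sigma>" using \<sigma> x by auto
    ultimately have "subst_fm \<sigma> (FORALL x \<psi>) = FORALL x (subst_fm \<sigma> \<psi>)"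
      using subst_FORALL[of \<psi> x \<sigma>] by auto
    moreover have "x \<notin> fv_ctx \<Theta>" using \<Theta> x by auto
    ultimately show "HA (\<Theta> \<rhd> subst_fm \<sigma> (FORALL x \<psi>)) \<longleftrightarrow> HA (\<Theta> \<rhd> subst_fm \<sigma> \<phi>)"
      by (simp add: HA_FORALL_iff \<psi>[OF \<Theta> \<sigma>])
  qed
qed

text \<open>Later \<open>W\<close> consists of the induction variables in force. Varying
  \<open>\<sigma>\<close> then makes the single formula \<open>\<kappa>\<close> express the
  induction claim, its base case and its step.\<close>

lemma ex_conjunction:
  assumes "finite \<S>"
  shows "\<exists>\<kappa>. fv_fm \<kappa> \<subseteq> W \<and>
    (\<forall>\<Theta> \<sigma>. fv_ctx \<Theta> \<subseteq> W \<longrightarrow> (\<forall>x. x \<notin> W \<longrightarrow> \<sigma> x = Var x) \<longrightarrow> (\<forall>x\<in>W. fv_tm (\<sigma> x) \<subseteq> W) \<longrightarrow>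
      (HA (\<Theta> \<rhd> subst_fm \<sigma> \<kappa>) \<longleftrightarrow> (\<forall>S\<in>\<S>. HA (with_hyps \<Theta> (subst_seq \<sigma> S)))))"
  using assms
proof (induction \<S>)
  case empty
  \<comment> \<open>Truth serves as the empty conjunction.\<close>
  show ?case by (rule exI[of _ "Neg Bot"]) (auto simp: HA_Imp_iff HA_ax)
next
  case (insert S \<S>)
  then obtain \<kappa> where \<kappa>: "fv_fm \<kappa> \<subseteq> W"
      "\<And>\<Theta> \<sigma>. fv_ctx \<Theta> \<subseteq> W \<Longrightarrow> (\<forall>x. x \<notin> W \<longrightarrow> \<sigma> x = Var x) \<Longrightarrow> (\<forall>x\<in>W. fv_tm (\<sigma> x) \<subseteq> W) \<Longrightarrow>
        HA (\<Theta> \<rhd> subst_fm \<sigma> \<kappa>) \<longleftrightarrow> (\<forall>S\<in>\<S>. HA (with_hyps \<Theta> (subst_seq \<sigma> S)))"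
    by blast
  obtain \<phi> where \<phi>: "\<And>\<Theta> \<sigma>. HA (\<Theta> \<rhd> subst_fm \<sigma> \<phi>) \<longleftrightarrow> HA (with_hyps \<Theta> (subst_seq \<sigma> S))"
    using ex_implication by (cases S) metis
  obtain \<psi> where \<psi>: "fv_fm \<psi> = fv_fm \<phi> - (fv_fm \<phi> - W)"
      "\<And>\<Theta> \<sigma>. fv_ctx \<Theta> \<subseteq> W \<Longrightarrow> (\<forall>x. x \<notin> W \<longrightarrow> \<sigma> x = Var x) \<Longrightarrow> (\<forall>x\<in>W. fv_tm (\<sigma> x) \<subseteq> W) \<Longrightarrow>
        HA (\<Theta> \<rhd> subst_fm \<sigma> \<psi>) \<longleftrightarrow> HA (\<Theta> \<rhd> subst_fm \<sigma> \<phi>)"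
    using ex_closure[of "fv_fm \<phi> - W" W \<phi>, OF finite_Diff[OF finite_fv_fm]] by (metis Diff_disjoint Int_commute)
  show ?case
    by (rule exI[of _ "And \<psi> \<kappa>"]) (use \<kappa> \<psi> in \<open>auto simp: HA_And_iff \<phi>\<close>)
qed

text \<open>A case distinction is an induction whose step is proved outright, the induction
  hypothesis being added by weakening.\<close>

lemma HA_case:
  assumes "HA (subst_seq (Var(x := Zero)) S)" "HA (subst_seq (Var(x := Succ (Var x))) S)"
  shows "HA S"
proof -
  obtain \<phi> where \<phi>: "\<And>\<Theta> \<sigma>. HA (\<Theta> \<rhd> subst_fm \<sigma> \<phi>) \<longleftrightarrow> HA (with_hyps \<Theta> (subst_seq \<sigma> S))"
    using ex_implication by (cases S) metis
  have [simp]: "with_hyps {||} S' = S'" for S' by (cases S') simp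
  have [simp]: "subst_seq Var S = S" by (cases S) (simp add: fimage_subst_fm_id subst_fm_Var)
  have "HA ({||} \<rhd> \<phi>)"
  proof (rule HA_induct)
    show "HA ({||} \<rhd> subst_fm (Var(x := Zero)) \<phi>)" using assms by (simp add: \<phi>)
    have "HA ({||} \<rhd> subst_fm (Var(x := Succ (Var x))) \<phi>)" using assms by (simp add: \<phi>)
    then show "HA ({|\<phi>|} \<rhd> subst_fm (Var(x := Succ (Var x))) \<phi>)" by (rule HA_weak) auto
  qed simp
  then show ?thesis using \<phi>[of "{||}" Var] by (simp add: subst_fm_Var)
qed

section \<open>Walks through strongly connected sets\<close>

text \<open>The end point \<open>c\<close> is left out of the list, so that consecutive walks can
  simply be appended.\<close>

lemma trancl_walk:
  assumes "(a, c) \<in> R\<^sup>+"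
  shows "\<exists>xs. xs \<noteq> [] \<and> hd xs = a \<and> successively (\<lambda>u v. (u, v) \<in> R) xs \<and> (last xs, c) \<in> R"
  using assms
proof (induction rule: trancl_induct)
  case (base c)
  then show ?case by (intro exI[of _ "[a]"]) auto
next
  case (step b c)
  then obtain xs where "xs \<noteq> []" "hd xs = a" "successively (\<lambda>u v. (u, v) \<in> R) xs" "(last xs, b) \<in> R"
    by blast
  with step show ?case by (intro exI[of _ "xs @ [b]"]) (auto simp: successively_append_iff)
qed

text \<open>By induction on \<open>A\<close>: a closed walk from \<open>u\<close> is extended by a
  round trip from \<open>u\<close> to the new element.\<close>

lemma closed_walk:
  assumes "finite A" "u \<in> C" "A \<subseteq> C" and conn: "\<And>v w. v \<in> C \<Longrightarrow> w \<in> C \<Longrightarrow> (v, w) \<in> R\<^sup>+"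
  shows "\<exists>xs. xs \<noteq> [] \<and> hd xs = u \<and> successively (\<lambda>u v. (u, v) \<in> R) xs \<and> (last xs, u) \<in> R \<and> A \<subseteq> set xs"
  using assms(1-3)
proof (induction A)
  case empty
  then show ?case using trancl_walk[OF conn[of u u]] by auto
next
  case (insert v A)
  then obtain xs where xs: "xs \<noteq> []" "hd xs = u" "successively (\<lambda>u v. (u, v) \<in> R) xs"
    "(last xs, u) \<in> R" "A \<subseteq> set xs" by auto
  obtain ys where ys: "ys \<noteq> []" "hd ys = u" "successively (\<lambda>u v. (u, v) \<in> R) ys" "(last ys, v) \<in> R"
    using trancl_walk[OF conn[of u v]] insert.prems by auto
  obtain zs where zs: "zs \<noteq> []" "hd zs = v" "successively (\<lambda>u v. (u, v) \<in> R) zs" "(last zs, u) \<in> R"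
    using trancl_walk[OF conn[of v u]] insert.prems by auto
  have "v \<in> set zs" using zs by (metis hd_in_set)
  with xs ys zs show ?case
    by (intro exI[of _ "xs @ ys @ zs"]) (auto simp: successively_append_iff)
qed

lemma recurrent_walk:
  assumes "finite C" "u \<in> C" "\<And>v w. v \<in> C \<Longrightarrow> w \<in> C \<Longrightarrow> (v, w) \<in> R\<^sup>+"
  obtains f :: "nat \<Rightarrow> 'a" where "f 0 = u" "\<And>n. (f n, f (Suc n)) \<in> R" "\<And>v. v \<in> C \<Longrightarrow> \<exists>\<^sub>\<infinity>n. f n = v"
proof -
  obtain xs where xs: "xs \<noteq> []" "hd xs = u" "successively (\<lambda>u v. (u, v) \<in> R) xs"
    "(last xs, u) \<in> R" "C \<subseteq> set xs"
    using closed_walk[OF assms(1,2) order.refl assms(3)] by blast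
  let ?l = "length xs"
  let ?f = "\<lambda>n. xs ! (n mod ?l)"
  have "?f 0 = u" using xs by (simp add: hd_conv_nth)
  moreover have "(?f n, ?f (Suc n)) \<in> R" for n
  proof (cases "Suc (n mod ?l) = ?l")
    case True
    then have "n mod ?l = ?l - 1" by simp
    with True xs show ?thesis by (simp add: mod_Suc hd_conv_nth last_conv_nth)
  next
    case False
    moreover have "n mod ?l < ?l" using xs by simp
    ultimately have "Suc (n mod ?l) < ?l" by linarith
    with xs(3) show ?thesis by (simp add: mod_Suc successively_conv_nth)
  qed
  moreover have "\<exists>\<^sub>\<infinity>n. ?f n = v" if v: "v \<in> C" for v
  proof -
    obtain i where i: "i < ?l" "xs ! i = v" using xs(5) v by (metis in_set_conv_nth subsetD)
    \<comment> \<open>After \<open>m\<close> full rounds the walk is again at position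
      \<open>i\<close>, and the index is at least \<open>m\<close> because \<open>?l\<close> is
      positive.\<close>
    have "\<exists>n\<ge>m. ?f n = v" for m
      using i xs by (intro exI[of _ "m * ?l + i"]) (auto simp: trans_le_add1)
    then show ?thesis by (simp add: INFM_nat_le)
  qed
  ultimately show ?thesis by (rule that[of ?f])
qed

section \<open>Unravelling a cyclic proof\<close>

locale cyclic_proof =
  fixes T \<beta> lab r
  assumes cha: "CHA_proof T \<beta> lab r"
begin

text \<open>Jumps from a bud to its companion count as edges, so infinite branches are exactly the
  infinite paths from the root.\<close>

definition edges :: "(node \<times> node) set" where
  "edges = {(u, v). u \<in> T \<and> v \<in> T \<and> ((\<exists>i. v = u @ [i]) \<or> \<beta> u = Some v)}"

lemma pre: "pre_proof T \<beta> lab r" and tree: "finite_tree T" and finite_T: "finite T" and root: "[] \<in> T"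
  using cha by (auto simp: CHA_proof_def pre_proof_def cyclic_tree_def finite_tree_def)

lemma take_in_T: "u \<in> T \<Longrightarrow> take n u \<in> T"
proof (induction u arbitrary: n rule: rev_induct)
  case (snoc i u)
  then have "u \<in> T" using tree by (auto simp: finite_tree_def)
  with snoc show ?case by (cases "n \<le> length u") auto
qed simp

text \<open>The trace condition is applied to a branch that reaches \<open>u\<close> and then tours
  \<open>C\<close> forever. Every node of \<open>C\<close> recurs, so a variable that is eventually
  free is free in all of \<open>C\<close>.\<close>

lemma progressing_variable:
  assumes "C \<subseteq> T" "u \<in> C" and conn: "\<And>v w. v \<in> C \<Longrightarrow> w \<in> C \<Longrightarrow> (v, w) \<in> (Restr edges C)\<^sup>+"
  obtains z w where "\<And>v. v \<in> C \<Longrightarrow> z \<in> fv_seq (lab v)" "w \<in> C" "r w = Some (Case z)"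
proof -
  have "finite C" using assms(1) finite_T by (rule finite_subset)
  then obtain f where f: "f 0 = u" "\<And>n. (f n, f (Suc n)) \<in> Restr edges C"
    "\<And>v. v \<in> C \<Longrightarrow> \<exists>\<^sub>\<infinity>n. f n = v"
    using recurrent_walk[of C u "Restr edges C"] assms by blast
  let ?l = "length u"
  \<comment> \<open>A branch must start at the root: the prefixes of \<open>u\<close> lead to
    \<open>u\<close>, where \<open>f\<close> takes over with shifted index.\<close>
  let ?b = "\<lambda>n. if n < ?l then take n u else f (n - ?l)"
  have fC: "f n \<in> C" for n using f(2)[of n] by auto
  have "infinite_branch T \<beta> ?b"
    unfolding infinite_branch_def
  proof (intro conjI allI)
    show "?b 0 = []" using f(1) by auto
    show "?b n \<in> T" for n using fC assms(1,2) take_in_T by auto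
    show "(\<exists>i. ?b (Suc n) = ?b n @ [i]) \<or> \<beta> (?b n) = Some (?b (Suc n))" for n
    proof (cases "n < ?l")
      case True
      then have "?b (Suc n) = take (Suc n) u" using f(1) by auto
      with True show ?thesis by (auto simp: take_Suc_conv_app_nth)
    next
      case False
      then show ?thesis using f(2)[of "n - ?l"] by (auto simp: edges_def Suc_diff_le)
    qed
  qed
  then obtain z where z: "has_progressing_trace lab r ?b z"
    using cha by (auto simp: CHA_proof_def)
  then obtain N where N: "\<And>n. n \<ge> N \<Longrightarrow> z \<in> fv_seq (lab (?b n))"
    by (auto simp: has_progressing_trace_def has_trace_def)
  have "z \<in> fv_seq (lab v)" if v: "v \<in> C" for v
  proof -
    obtain n where "n \<ge> N" "f n = v" using f(3)[OF v] by (auto simp: INFM_nat_le)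
    with N[of "n + ?l"] show ?thesis by simp
  qed
  \<comment> \<open>From index \<open>?l\<close> on the branch stays in \<open>C\<close>, so this
    progress point lies in \<open>C\<close>.\<close>
  moreover obtain n where "n \<ge> ?l" "r (?b n) = Some (Case z)"
    using z unfolding has_progressing_trace_def INFM_nat_le by blast
  ultimately show ?thesis using that fC by auto
qed

lemma rule_at:
  assumes "u \<in> T" "r u = Some k"
  obtains Ps where "cha_rule k Ps (lab u)"
    "\<And>i. i < length Ps \<Longrightarrow> (u, u @ [i]) \<in> edges \<and> lab (u @ [i]) = Ps ! i"
proof -
  obtain Ps where "cha_rule k Ps (lab u)" "\<And>i. u @ [i] \<in> T \<longleftrightarrow> i < length Ps"
    "\<And>i. i < length Ps \<Longrightarrow> lab (u @ [i]) = Ps ! i"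
    using pre assms(2) unfolding pre_proof_def by blast
  with assms(1) that show ?thesis by (simp add: edges_def)
qed

text \<open>A bud takes its proof from its companion, and the basic rules tolerate
  \<open>\<Theta>\<close>. At a case node, the case variable must not occur in
  \<open>\<Theta>\<close>, so that the substitutions in the premises leave the hypotheses
  alone.\<close>

lemma node_step:
  assumes u: "u \<in> T" and \<Theta>: "fv_ctx \<Theta> \<subseteq> fv_seq (lab u)" "\<And>x. x \<in> fv_ctx \<Theta> \<Longrightarrow> r u \<noteq> Some (Case x)"
    and succs: "\<And>v. (u, v) \<in> edges \<Longrightarrow> HA (with_hyps \<Theta> (lab v))"
  shows "HA (with_hyps \<Theta> (lab u))"
proof (cases "r u")
  case None
  then obtain c where c: "\<beta> u = Some c" using pre u unfolding pre_proof_def by blast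
  moreover have "c \<in> T"
    using pre c by (auto simp: pre_proof_def cyclic_tree_def inner_nodes_def ran_def)
  ultimately have "(u, c) \<in> edges" using u by (simp add: edges_def)
  moreover have "lab u = lab c" using pre c by (simp add: pre_proof_def)
  ultimately show ?thesis using succs by simp
next
  case (Some k)
  obtain Ps where rule: "cha_rule k Ps (lab u)"
    and Ps: "\<And>i. i < length Ps \<Longrightarrow> (u, u @ [i]) \<in> edges \<and> lab (u @ [i]) = Ps ! i"
    using rule_at[OF u Some] by blast
  have HA: "HA (with_hyps \<Theta> P)" if "P \<in> set Ps" for P
    using that Ps succs by (metis in_set_conv_nth)
  show ?thesis
  proof (cases k)
    case Basic
    with rule HA \<Theta>(1) show ?thesis by (auto intro: base_rule_with_hyps)
  next
    case (Case x)
    with Some \<Theta>(2) have "x \<notin> fv_ctx \<Theta>" by auto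
    then have *: "with_hyps \<Theta> (subst_seq (Var(x := t)) (lab u)) = subst_seq (Var(x := t)) (with_hyps \<Theta> (lab u))" for t
      by (intro subst_with_hyps[symmetric]) auto
    show ?thesis
      by (rule HA_case[of x]) (use rule HA Case in \<open>auto simp flip: *\<close>)
  qed
qed

text \<open>
  \<open>Z\<close> is the set of outer induction variables and \<open>\<Theta>\<close> consists of their induction hypotheses.
\<close>

lemma unravel:
  assumes "C \<subseteq> T" "fv_ctx \<Theta> \<subseteq> Z"
    and "\<forall>u\<in>C. Z \<subseteq> fv_seq (lab u)" "\<forall>u\<in>C. \<forall>x\<in>Z. r u \<noteq> Some (Case x)"
    and "\<forall>u\<in>C. \<forall>v. (u, v) \<in> edges \<longrightarrow> v \<notin> C \<longrightarrow> HA (with_hyps \<Theta> (lab v))"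
  shows "\<forall>u\<in>C. HA (with_hyps \<Theta> (lab u))"
  using assms
proof (induction "card C" arbitrary: C \<Theta> Z rule: less_induct)
  case less
  note sub = less.prems(1) and \<Theta> = less.prems(2) and free = less.prems(3)
    and no_case = less.prems(4) and exits = less.prems(5)
  have fin: "finite C" using sub finite_T by (rule finite_subset)
  let ?R = "Restr edges C"
  \<comment> \<open>Either some \<open>u\<close> cannot reach all of \<open>C\<close> within
    \<open>C\<close>, or \<open>C\<close> is strongly connected, without or with an internal edge.
    Only the last case adds an induction.\<close>
  consider (split) u where "u \<in> C" "\<not> C \<subseteq> ?R\<^sup>* `` {u}"
    | (trivial) "\<forall>u\<in>C. C \<subseteq> ?R\<^sup>* `` {u}" "?R = {}"
    | (conn) "\<forall>u\<in>C. C \<subseteq> ?R\<^sup>* `` {u}" "?R \<noteq> {}"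
    by blast
  then show ?case
  proof cases
    case split
    \<comment> \<open>Within \<open>C\<close> no edge leaves the part reachable from
      \<open>u\<close>, so this part is proved first. Edges from the rest into it then count as
      exits to proved sequents.\<close>
    define D where "D = C \<inter> ?R\<^sup>* `` {u}"
    have "D \<subset> C" using split by (auto simp: D_def)
    then have cards: "card D < card C" "card (C - D) < card C"
      using fin split by (auto intro!: psubset_card_mono simp: D_def)
    have closed: "v' \<in> D" if "v \<in> D" "(v, v') \<in> edges" "v' \<in> C" for v v'
      using that by (auto simp: D_def intro: rtrancl_into_rtrancl)
    have D: "\<forall>v\<in>D. HA (with_hyps \<Theta> (lab v))"
    proof (rule less.hyps[OF cards(1) _ \<Theta>])
      show "\<forall>v\<in>D. \<forall>v'. (v, v') \<in> edges \<longrightarrow> v' \<notin> D \<longrightarrow> HA (with_hyps \<Theta> (lab v'))"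
        using exits closed \<open>D \<subset> C\<close> by blast
    qed (use sub free no_case \<open>D \<subset> C\<close> in blast)+
    have "\<forall>v\<in>C - D. HA (with_hyps \<Theta> (lab v))"
    proof (rule less.hyps[OF cards(2) _ \<Theta>])
      show "\<forall>v\<in>C - D. \<forall>v'. (v, v') \<in> edges \<longrightarrow> v' \<notin> C - D \<longrightarrow> HA (with_hyps \<Theta> (lab v'))"
        using exits D by blast
    qed (use sub free no_case in blast)+
    with D show ?thesis by blast
  next
    case trivial
    show ?thesis
    proof
      fix u assume u: "u \<in> C"
      show "HA (with_hyps \<Theta> (lab u))"
      proof (rule node_step)
        show "HA (with_hyps \<Theta> (lab v))" if "(u, v) \<in> edges" for v
          using trivial(2) exits that u by blast
      qed (use u sub \<Theta> free no_case in blast)+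
    qed
  next
    case conn
    then obtain a b where ab: "(a, b) \<in> ?R" by auto
    then have "a \<in> C" "b \<in> C" by auto
    \<comment> \<open>The detour through the edge from \<open>a\<close> to \<open>b\<close> makes
      the path nonempty even if \<open>v = w\<close>.\<close>
    have "(v, w) \<in> ?R\<^sup>+" if "v \<in> C" "w \<in> C" for v w
    proof -
      have "(v, a) \<in> ?R\<^sup>*" "(b, w) \<in> ?R\<^sup>*" using conn(1) that \<open>a \<in> C\<close> \<open>b \<in> C\<close> by blast+
      with ab show ?thesis by (meson rtrancl_into_trancl1 trancl_rtrancl_trancl)
    qed
    then obtain z w where z: "\<And>v. v \<in> C \<Longrightarrow> z \<in> fv_seq (lab v)" and w: "w \<in> C" "r w = Some (Case z)"
      using progressing_variable[OF sub \<open>a \<in> C\<close>] by metis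
    have "z \<notin> Z" using no_case w by blast
    define D where "D = {u \<in> C. r u = Some (Case z)}"
    let ?W = "insert z Z"
    have "finite D" using fin by (simp add: D_def)
    then obtain \<kappa> where \<kappa>: "fv_fm \<kappa> \<subseteq> ?W"
      "\<And>\<Theta> \<sigma>. fv_ctx \<Theta> \<subseteq> ?W \<Longrightarrow> (\<forall>x. x \<notin> ?W \<longrightarrow> \<sigma> x = Var x) \<Longrightarrow> (\<forall>x\<in>?W. fv_tm (\<sigma> x) \<subseteq> ?W) \<Longrightarrow>
        HA (\<Theta> \<rhd> subst_fm \<sigma> \<kappa>) \<longleftrightarrow> (\<forall>S\<in>lab ` D. HA (with_hyps \<Theta> (subst_seq \<sigma> S)))"
      using ex_conjunction[of "lab ` D" ?W] by (metis finite_imageI)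
    \<comment> \<open>The terms used for \<open>t\<close> are \<open>Var z\<close>,
      \<open>Zero\<close> and \<open>Succ (Var z)\<close>.\<close>
    have \<kappa>_subst: "HA (\<Theta>' \<rhd> subst_fm (Var(z := t)) \<kappa>) \<longleftrightarrow>
        (\<forall>u\<in>D. HA (with_hyps \<Theta>' (subst_seq (Var(z := t)) (lab u))))"
      if "fv_ctx \<Theta>' \<subseteq> ?W" "fv_tm t \<subseteq> {z}" for \<Theta>' t
    proof -
      have "\<forall>x\<in>?W. fv_tm ((Var(z := t)) x) \<subseteq> ?W" using that(2) by auto
      with \<kappa>(2)[OF that(1), of "Var(z := t)"] show ?thesis by simp
    qed
    have id: "subst_seq Var S = S" for S
      by (cases S) (simp add: fimage_subst_fm_id subst_fm_Var)
    have \<kappa>_iff: "HA (\<Theta>' \<rhd> \<kappa>) \<longleftrightarrow> (\<forall>u\<in>D. HA (with_hyps \<Theta>' (lab u)))" if "fv_ctx \<Theta>' \<subseteq> ?W" for \<Theta>'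
      using \<kappa>_subst[OF that, of "Var z"] by (simp add: id subst_fm_Var)
    let ?\<Theta> = "finsert \<kappa> \<Theta>"
    have fv\<Theta>: "fv_ctx ?\<Theta> \<subseteq> ?W" using \<kappa>(1) \<Theta> by auto
    have "HA (?\<Theta> \<rhd> \<kappa>)" by (rule HA_ax) simp
    then have D: "\<forall>u\<in>D. HA (with_hyps ?\<Theta> (lab u))" using \<kappa>_iff[OF fv\<Theta>] by simp
    have exits': "\<forall>u\<in>C. \<forall>v. (u, v) \<in> edges \<longrightarrow> v \<notin> C \<longrightarrow> HA (with_hyps ?\<Theta> (lab v))"
      using exits by (meson with_hyps_mono fsubset_finsertI)
    have "card (C - D) < card C"
      using fin w by (intro psubset_card_mono) (auto simp: D_def)
    \<comment> \<open>In the recursive call \<open>z\<close> joins \<open>Z\<close>: no case node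
      for \<open>z\<close> is left in \<open>C - D\<close>, and edges into \<open>D\<close> are
      exits whose sequents follow from \<open>\<kappa>\<close>.\<close>
    then have "\<forall>u\<in>C - D. HA (with_hyps ?\<Theta> (lab u))"
    proof (rule less.hyps[OF _ _ fv\<Theta>])
      show "\<forall>u\<in>C - D. \<forall>v. (u, v) \<in> edges \<longrightarrow> v \<notin> C - D \<longrightarrow> HA (with_hyps ?\<Theta> (lab v))"
        using exits' D by blast
    qed (use sub free no_case z in \<open>auto simp: D_def\<close>)
    with D have all: "HA (with_hyps ?\<Theta> (lab u))" if "u \<in> C" for u
      using that by blast
    have children: "(u, u @ [0]) \<in> edges \<and> lab (u @ [0]) = subst_seq (Var(z := Zero)) (lab u)"
      "(u, u @ [1]) \<in> edges \<and> lab (u @ [1]) = subst_seq (Var(z := Succ (Var z))) (lab u)" if u: "u \<in> D" for u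
    proof -
      have "u \<in> T" "r u = Some (Case z)" using u sub by (auto simp: D_def)
      then obtain Ps where "cha_rule (Case z) Ps (lab u)"
        and Ps: "\<And>i. i < length Ps \<Longrightarrow> (u, u @ [i]) \<in> edges \<and> lab (u @ [i]) = Ps ! i"
        using rule_at by blast
      then show "(u, u @ [0]) \<in> edges \<and> lab (u @ [0]) = subst_seq (Var(z := Zero)) (lab u)"
        "(u, u @ [1]) \<in> edges \<and> lab (u @ [1]) = subst_seq (Var(z := Succ (Var z))) (lab u)"
        using Ps[of 0] Ps[of 1] by auto
    qed
    have "HA (\<Theta> \<rhd> \<kappa>)"
    proof (rule HA_induct)
      show "z \<notin> fv_ctx \<Theta>" using \<Theta> \<open>z \<notin> Z\<close> by auto
      have "HA (with_hyps \<Theta> (subst_seq (Var(z := Zero)) (lab u)))" if u: "u \<in> D" for u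
      proof -
        have "z \<notin> fv_seq (lab (u @ [0]))"
          using children(1)[OF u] by (auto simp: fv_subst_seq split: if_splits)
        then have "u @ [0] \<notin> C" using z by blast
        then show ?thesis using exits children(1)[OF u] u by (metis (no_types, lifting) D_def mem_Collect_eq)
      qed
      then show "HA (\<Theta> \<rhd> subst_fm (Var(z := Zero)) \<kappa>)"
        using \<kappa>_subst[of \<Theta> Zero] \<Theta> by auto
      \<comment> \<open>The right child may lie in \<open>C\<close> or outside; \<open>all\<close>
        covers the former case, \<open>exits'\<close> the latter.\<close>
      have "HA (with_hyps ?\<Theta> (subst_seq (Var(z := Succ (Var z))) (lab u)))" if u: "u \<in> D" for u
        using exits' all children(2)[OF u] u by (metis (no_types, lifting) D_def mem_Collect_eq)
      then show "HA (?\<Theta> \<rhd> subst_fm (Var(z := Succ (Var z))) \<kappa>)"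
        using \<kappa>_subst[OF fv\<Theta>, of "Succ (Var z)"] by auto
    qed
    show ?thesis
    proof
      fix u assume "u \<in> C"
      obtain \<Gamma> \<delta> where u: "lab u = \<Gamma> \<rhd> \<delta>" by (cases "lab u")
      have "HA (finsert \<kappa> (\<Theta> |\<union>| \<Gamma>) \<rhd> \<delta>)" using all[OF \<open>u \<in> C\<close>] by (simp add: u)
      moreover have "HA (\<Theta> |\<union>| \<Gamma> \<rhd> \<kappa>)" using \<open>HA (\<Theta> \<rhd> \<kappa>)\<close> by (rule HA_weak) auto
      ultimately show "HA (with_hyps \<Theta> (lab u))" by (auto simp: u intro: HA_cut)
    qed
  qed
qed

lemma HA_root: "HA (lab [])"
proof -
  have "\<forall>u\<in>T. HA (with_hyps {||} (lab u))"
    \<comment> \<open>No edge leaves the whole tree, and there are no outer induction variables or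
      hypotheses yet, so all conditions hold trivially.\<close>
    by (rule unravel[where Z = "{}"]) (auto simp: edges_def)
  with root have "HA (with_hyps {||} (lab []))" by blast
  then show ?thesis by (cases "lab []") simp
qed

end

theorem theorem6p1:
  fixes \<Gamma> :: "fm fset" and \<delta> :: fm
  assumes "CHA (\<Gamma> \<rhd> \<delta>)"
  shows "HA (\<Gamma> \<rhd> \<delta>)"
proof -
  obtain T \<beta> lab r where "CHA_proof T \<beta> lab r" and lab: "lab [] = \<Gamma> \<rhd> \<delta>"
    using assms by (auto simp: CHA_def)
  then interpret cyclic_proof T \<beta> lab r by unfold_locales
  show ?thesis using HA_root by (simp add: lab)
qed

end
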